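(* For every $K_3N$ $n=pqr$, $$C\le\frac12\left(p^2+2p+\frac12\sqrt{4p-3}+\frac12\right),$$ with equality if and only if $E=2$ and $F=G=1$.
   Context: A $K_3N$ (Korselt number with three factors) is an integer $n$ together with a factorisation $n=pqr$, where $1<p<q<r$ are odd integers (not necessarily prime) such that each of $p-1,\ q-1,\ r-1$ divides $n-1$, and such that $E:=\dfrac{pq-1}{r-1}$ (which is an integer by the divisibility condition) satisfies $E\ge 2$. Put $H:=\gcd(p-1,q-1,r-1)$, $A:=\frac{p-1}{H}$, $B:=\frac{q-1}{H}$, $C:=\frac{r-1}{H}$, $F:=H\left(\frac1A+\frac1B+\frac1C\right)+\frac1{AB}+\frac1{AC}+\frac1{BC}$ (which is a positive integer), and $G:=AF-H$. *)

theory Defs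
  imports Complex_Main
begin

text \<open>
  Korselt numbers with three factors (\<open>K\<^sub>3N\<close>) together with the parameters attached to a
  factorisation \<open>n = p q r\<close>.  The factors are integers that need not be prime.  The parameters
  \<open>E\<close>, \<open>A\<close>, \<open>B\<close>, \<open>C\<close> are written with \<open>div\<close>; the lemmas below show that for a \<open>K\<^sub>3N\<close>
  all these divisions are exact.  \<open>F\<close> and \<open>G\<close> are sums of fractions and are therefore real
  numbers by definition.
\<close>

definition parE :: "int \<Rightarrow> int \<Rightarrow> int \<Rightarrow> int" where
  "parE p q r = (p * q - 1) div (r - 1)"

definition K3N :: "int \<Rightarrow> int \<Rightarrow> int \<Rightarrow> int \<Rightarrow> bool" where
  "K3N n p q r \<longleftrightarrow>
     n = p * q * r \<and> 1 < p \<and> p < q \<and> q < r \<and> odd p \<and> odd q \<and> odd r \<and>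
     (p - 1) dvd (n - 1) \<and> (q - 1) dvd (n - 1) \<and> (r - 1) dvd (n - 1) \<and>
     parE p q r \<ge> 2"

definition parH :: "int \<Rightarrow> int \<Rightarrow> int \<Rightarrow> int" where
  "parH p q r = gcd (p - 1) (gcd (q - 1) (r - 1))"

definition parA :: "int \<Rightarrow> int \<Rightarrow> int \<Rightarrow> int" where
  "parA p q r = (p - 1) div parH p q r"

definition parB :: "int \<Rightarrow> int \<Rightarrow> int \<Rightarrow> int" where
  "parB p q r = (q - 1) div parH p q r"

definition parC :: "int \<Rightarrow> int \<Rightarrow> int \<Rightarrow> int" where
  "parC p q r = (r - 1) div parH p q r"

definition parF :: "int \<Rightarrow> int \<Rightarrow> int \<Rightarrow> real" where
  "parF p q r =
     (let H = real_of_int (parH p q r); A = real_of_int (parA p q r);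
          B = real_of_int (parB p q r); C = real_of_int (parC p q r)
      in H * (1 / A + 1 / B + 1 / C) + 1 / (A * B) + 1 / (A * C) + 1 / (B * C))"

definition parG :: "int \<Rightarrow> int \<Rightarrow> int \<Rightarrow> real" where
  "parG p q r = real_of_int (parA p q r) * parF p q r - real_of_int (parH p q r)"

lemma K3N_parE_exact:
  assumes "K3N n p q r"
  shows "parE p q r * (r - 1) = p * q - 1"
proof -
  have "(r - 1) dvd (p * q * r - 1)"
    using assms by (auto simp: K3N_def)
  moreover have "p * q * r - 1 = (r - 1) * (p * q) + (p * q - 1)"
    by (simp add: algebra_simps)
  ultimately have "(r - 1) dvd (p * q - 1)"
    by (metis dvd_add_right_iff dvd_triv_left)
  then show ?thesis
    by (simp add: parE_def)
qed

lemma parABC_exact: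
  shows "parA p q r * parH p q r = p - 1"
    and "parB p q r * parH p q r = q - 1"
    and "parC p q r * parH p q r = r - 1"
proof -
  have "parH p q r dvd p - 1" "parH p q r dvd q - 1" "parH p q r dvd r - 1"
    unfolding parH_def by (auto intro: dvd_trans[OF gcd_dvd2])
  then show "parA p q r * parH p q r = p - 1"
    and "parB p q r * parH p q r = q - 1"
    and "parC p q r * parH p q r = r - 1"
    by (simp_all add: parA_def parB_def parC_def)
qed

end

(* With p - 1 = H A, q - 1 = H B, r - 1 = H C, the Korselt conditions make A, B, C pairwise
   coprime and turn into the integer equations C E = p B + A, G B = p + E and F A = G + H.
   Eliminating B gives C = p^2 / (E G) + p / G + A / E. For G >= 2 the trivial bound A <= p - 1
   makes this too small. For G = 1 it is at most p^2 / 2 + p + A / 2, with equality iff E = 2;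
   and F A = 1 + H gives A <= H + 1, that is A (A - 1) <= p - 1, or 2 A - 1 <= sqrt (4 p - 3),
   with equality iff F = 1. *)

theory Submission
  imports Defs
begin

lemma K3N_dvd_prods:
  assumes "K3N n p q r"
  shows "(p - 1) dvd (q * r - 1)" and "(q - 1) dvd (p * r - 1)"
proof -
  have d: "(p - 1) dvd (p * q * r - 1)" "(q - 1) dvd (p * q * r - 1)"
    using assms by (auto simp: K3N_def)
  have "p * q * r - 1 = (p - 1) * (q * r) + (q * r - 1)"
    by (simp add: algebra_simps)
  with d(1) show "(p - 1) dvd (q * r - 1)"
    by (metis dvd_add_right_iff dvd_triv_left)
  have "p * q * r - 1 = (q - 1) * (p * r) + (p * r - 1)"
    by (simp add: algebra_simps)
  with d(2) show "(q - 1) dvd (p * r - 1)"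
    by (metis dvd_add_right_iff dvd_triv_left)
qed

lemma parH_pos:
  assumes "1 < p"
  shows "0 < parH p q r"
proof -
  have "parH p q r \<noteq> 0" using assms by (simp add: parH_def)
  moreover have "0 \<le> parH p q r" by (simp add: parH_def)
  ultimately show ?thesis by linarith
qed

text \<open>\<open>parH\<close> is the greatest common divisor, so a further common factor
  \<open>d\<close> of the three cofactors would make \<open>d * parH\<close> divide it too.\<close>

lemma common_dvd_parABC_is_unit:
  assumes "1 < p" "d dvd parA p q r" "d dvd parB p q r" "d dvd parC p q r"
  shows "is_unit d"
proof -
  let ?H = "parH p q r"
  have "d * ?H dvd p - 1" "d * ?H dvd q - 1" "d * ?H dvd r - 1"
    using assms(2-4) by (simp_all flip: parABC_exact[of p q r] add: mult_dvd_mono)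
  then have "d * ?H dvd ?H"
    by (subst (2) parH_def) (intro gcd_greatest)
  then have "d * ?H dvd 1 * ?H" by simp
  then show ?thesis
    using parH_pos[OF assms(1), of q r] by (simp only: dvd_mult_cancel_right) auto
qed

text \<open>Moves everything to integers: \<open>F\<close> and \<open>G\<close> arise as exact
  quotients and are only then identified with the real-valued \<open>parF\<close> and
  \<open>parG\<close>. The bounds below use nothing but these equations and signs.\<close>

lemma K3N_parameters:
  assumes K: "K3N n p q r"
  obtains A B C E F G H :: int
  where "A = parA p q r" "B = parB p q r" "C = parC p q r" "E = parE p q r" "H = parH p q r"
    and "parF p q r = F" "parG p q r = G"
    and "0 < H" "0 < A" "0 < B" "0 < C" "2 \<le> E" "0 < F" "0 < G"
    and "p = H * A + 1" "C * E = p * B + A" "G * B = p + E" "F * A = G + H"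
proof -
  define A B C E H where defs: "A = parA p q r" "B = parB p q r" "C = parC p q r"
    "E = parE p q r" "H = parH p q r"
  have p1: "1 < p" "p < q" "q < r" and E: "2 \<le> E"
    using K by (auto simp: K3N_def defs)
  have H: "0 < H" using parH_pos p1 by (simp add: defs)
  have p: "p = H * A + 1" and q: "q = H * B + 1" and r: "r = H * C + 1"
    using parABC_exact[of p q r] by (simp_all add: defs algebra_simps)
  have "0 < H * A" "0 < H * B" "0 < H * C" using p1 p q r by linarith+
  then have pos: "0 < A" "0 < B" "0 < C" using H by (simp_all add: zero_less_mult_iff)
  \<comment> \<open>These are \<open>q * r - 1\<close> and \<open>p * r - 1\<close> expanded, with
    one factor \<open>H\<close> to cancel.\<close>
  have "H * A dvd H * (H * B * C + B + C)" "H * B dvd H * (H * A * C + A + C)"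
    using K3N_dvd_prods[OF K] unfolding p q r by (simp_all add: algebra_simps)
  then have dA: "A dvd H * B * C + B + C" and dB: "B dvd H * A * C + A + C"
    using H by simp_all
  have "H * (C * E) = H * (p * B + A)"
    using K3N_parE_exact[OF K] unfolding defs(4)[symmetric] unfolding p q r
    by (simp add: algebra_simps)
  then have CE: "C * E = p * B + A" using H by simp
  have unit: "is_unit d" if "d dvd A" "d dvd B" "d dvd C" for d
    using common_dvd_parABC_is_unit[OF p1(1)] that unfolding defs by blast
  \<comment> \<open>In all three coprimality proofs, \<open>dA\<close> or \<open>dB\<close> forces a
    common divisor of two of the cofactors to divide the third, so \<open>unit\<close>
    applies.\<close>
  have AB: "coprime A B"
  proof (rule coprimeI)
    fix d assume d: "d dvd A" "d dvd B"
    then have "d dvd H * B * C + B + C" using dA dvd_trans by blast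
    moreover have "H * B * C + B + C = B * (H * C + 1) + C" by (simp add: algebra_simps)
    ultimately have "d dvd C" using d by (metis dvd_add_right_iff dvd_mult2)
    with d show "is_unit d" by (rule unit)
  qed
  have AC: "coprime A C"
  proof (rule coprimeI)
    fix d assume d: "d dvd A" "d dvd C"
    then have "d dvd H * B * C + B + C" using dA dvd_trans by blast
    moreover have "H * B * C + B + C = C * (H * B + 1) + B" by (simp add: algebra_simps)
    ultimately have "d dvd B" using d by (metis dvd_add_right_iff dvd_mult2)
    with d show "is_unit d" by (blast intro: unit)
  qed
  have BC: "coprime B C"
  proof (rule coprimeI)
    fix d assume d: "d dvd B" "d dvd C"
    then have "d dvd H * A * C + A + C" using dB dvd_trans by blast
    moreover have "H * A * C + A + C = C * (H * A + 1) + A" by (simp add: algebra_simps)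
    ultimately have "d dvd A" using d by (metis dvd_add_right_iff dvd_mult2)
    with d show "is_unit d" by (blast intro: unit)
  qed
  \<comment> \<open>Both summands on the right are multiples of \<open>B\<close>, and
    \<open>C\<close> cancels by coprimality; \<open>G\<close> is the quotient of
    \<open>p + E\<close> by \<open>B\<close>.\<close>
  have "C * (p + E) = B * (H * A + 1) + (H * A * C + A + C)"
    unfolding distrib_left CE by (simp add: p algebra_simps)
  then have "B dvd C * (p + E)" using dB by simp
  then have "B dvd p + E" using BC by (simp add: coprime_dvd_mult_right_iff)
  then obtain G where G: "G * B = p + E" by (metis dvdE mult.commute)
  \<comment> \<open>The aim is a multiple of \<open>A\<close> plus the sum in \<open>dA\<close>;
    then \<open>B\<close> and \<open>C\<close> cancel, and \<open>F\<close> is the quotient of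
    \<open>G + H\<close> by \<open>A\<close>.\<close>
  have "B * C * (G + H) = C * (G * B) + B * C * H" by (simp add: algebra_simps)
  also have "\<dots> = C * E + C * p + B * C * H" unfolding G by (simp add: algebra_simps)
  also have "\<dots> = A * (H * B + H * C + 1) + (H * B * C + B + C)"
    unfolding CE by (simp add: p algebra_simps)
  finally have "A dvd B * C * (G + H)" using dA by simp
  then have "A dvd G + H" using AB AC by (simp add: coprime_dvd_mult_right_iff)
  then obtain F where F: "F * A = G + H" by (metis dvdE mult.commute)
  have "0 < G * B" using G p1 E by linarith
  then have Gpos: "0 < G" using pos by (simp add: zero_less_mult_iff)
  have "0 < F * A" using F Gpos H by linarith
  then have Fpos: "0 < F" using pos by (simp add: zero_less_mult_iff)
  \<comment> \<open>The chain ends in the numerator of \<open>parF\<close> over the common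
    denominator \<open>A * B * C\<close>.\<close>
  have "F * (A * B * C) = (F * A) * B * C" by (simp add: algebra_simps)
  also have "\<dots> = (G * B) * C + H * B * C" unfolding F by (simp add: algebra_simps)
  also have "\<dots> = p * C + C * E + H * B * C" unfolding G by (simp add: algebra_simps)
  also have "\<dots> = H * (B * C + A * C + A * B) + C + B + A"
    unfolding CE by (simp add: p algebra_simps)
  finally have "real_of_int (F * (A * B * C)) =
      real_of_int (H * (B * C + A * C + A * B) + C + B + A)"
    by simp
  then have parF: "parF p q r = F"
    unfolding parF_def Let_def defs[symmetric] using pos by (simp add: field_simps)
  have "parG p q r = real_of_int (F * A - H)"
    by (simp add: parG_def parF defs)
  then have parG: "parG p q r = G" unfolding F by simp
  show ?thesis
    by (rule that[OF defs parF parG H pos E Fpos Gpos p CE G F])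
qed

text \<open>Here \<open>B\<close> is at most half of \<open>p + E\<close>; inserting this and
  \<open>A < p\<close> into \<open>C * E = p * B + A\<close> leaves enough room for a strict
  bound.\<close>

lemma two_C_less_if_G_ge_2:
  fixes A B C E G p :: int
  assumes "0 < A" "A < p" "0 < B" "0 < C" "2 \<le> E" "2 \<le> G" "C * E = p * B + A" "G * B = p + E"
  shows "2 * C < p\<^sup>2 + 2 * p"
proof -
  have "2 * B \<le> G * B" using assms(3,6) by (intro mult_right_mono) auto
  then have "2 * B \<le> p + E" using assms by linarith
  then have "p * (2 * B) \<le> p * (p + E)" using assms by (intro mult_left_mono) auto
  then have "2 * (C * E) \<le> p\<^sup>2 + p * E + 2 * A"
    unfolding assms(7) by (simp add: algebra_simps power2_eq_square)
  also have "\<dots> < p\<^sup>2 + p * E + 2 * p" using assms by simp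
  also have "\<dots> \<le> E * (p\<^sup>2 + 2 * p)"
  proof -
    \<comment> \<open>After moving \<open>p * E\<close> to the right, the claim is
      \<open>p\<^sup>2 + 2 * p \<le> E * (p\<^sup>2 + p)\<close>.\<close>
    have "2 * (p\<^sup>2 + p) \<le> E * (p\<^sup>2 + p)" using assms by (intro mult_right_mono) auto
    moreover have "0 \<le> p\<^sup>2" by simp
    ultimately have "2 * (p\<^sup>2 + p) - p\<^sup>2 \<le> E * (p\<^sup>2 + p)" by linarith
    then show ?thesis by (simp add: algebra_simps)
  qed
  finally have "E * (2 * C) < E * (p\<^sup>2 + 2 * p)" by (simp add: algebra_simps)
  then show ?thesis using assms by simp
qed

text \<open>Multiplied by \<open>E\<close>, the slack in the bound factors as
  \<open>(E - 2) * (p\<^sup>2 + A)\<close> with positive second factor, which settles the inequality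
  and its equality case together.\<close>

lemma two_C_le_if_G_eq_1:
  fixes A B C E p :: int
  assumes "0 < A" "2 \<le> E" "C * E = p * B + A" "B = p + E"
  shows "2 * C \<le> p\<^sup>2 + 2 * p + A" and "2 * C = p\<^sup>2 + 2 * p + A \<longleftrightarrow> E = 2"
proof -
  have eq: "E * (p\<^sup>2 + 2 * p + A - 2 * C) = (E - 2) * (p\<^sup>2 + A)"
    using assms(3) unfolding assms(4) by (simp add: algebra_simps power2_eq_square)
  have s: "0 < p\<^sup>2 + A" using assms(1) by (simp add: add_nonneg_pos)
  have "0 \<le> E * (p\<^sup>2 + 2 * p + A - 2 * C)" unfolding eq using s assms(2) by simp
  then show "2 * C \<le> p\<^sup>2 + 2 * p + A" using assms(2) by (simp add: zero_le_mult_iff)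
  have "2 * C = p\<^sup>2 + 2 * p + A \<longleftrightarrow> E * (p\<^sup>2 + 2 * p + A - 2 * C) = 0"
    using assms(2) by auto
  also have "\<dots> \<longleftrightarrow> E = 2" unfolding eq using s by auto
  finally show "2 * C = p\<^sup>2 + 2 * p + A \<longleftrightarrow> E = 2" .
qed

text \<open>Eliminating \<open>H\<close> shows that \<open>4 * p - 3\<close> exceeds the square of
  \<open>2 * A - 1\<close> by \<open>4 * (F - 1) * A\<^sup>2\<close>, which vanishes exactly for
  \<open>F = 1\<close>.\<close>

lemma A_le_if_G_eq_1:
  fixes A F H p :: int
  assumes "0 < A" "0 < F" "p = H * A + 1" "F * A = 1 + H"
  shows "2 * real_of_int A - 1 \<le> sqrt (4 * real_of_int p - 3)"
    and "2 * real_of_int A - 1 = sqrt (4 * real_of_int p - 3) \<longleftrightarrow> F = 1"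
proof -
  have "4 * p - 3 = (2 * A - 1)\<^sup>2 + 4 * (F - 1) * A\<^sup>2"
  proof -
    have H: "H = F * A - 1" using assms(4) by simp
    show ?thesis unfolding assms(3) H by (simp add: algebra_simps power2_eq_square)
  qed
  then have "real_of_int (4 * p - 3) = real_of_int ((2 * A - 1)\<^sup>2 + 4 * (F - 1) * A\<^sup>2)"
    by simp
  then have eq: "4 * real_of_int p - 3 =
      (2 * real_of_int A - 1)\<^sup>2 + 4 * (real_of_int F - 1) * (real_of_int A)\<^sup>2"
    by simp
  have F: "0 \<le> 4 * (real_of_int F - 1) * (real_of_int A)\<^sup>2" using assms by simp
  then show "2 * real_of_int A - 1 \<le> sqrt (4 * real_of_int p - 3)"
    unfolding eq by (intro real_le_rsqrt) simp
  \<comment> \<open>The sign makes \<open>2 * A - 1\<close> the root of its own square, so equality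
    can be tested under the root.\<close>
  have pos: "0 \<le> 2 * real_of_int A - 1" using assms(1) by linarith
  have "2 * real_of_int A - 1 = sqrt (4 * real_of_int p - 3) \<longleftrightarrow>
      sqrt ((2 * real_of_int A - 1)\<^sup>2) = sqrt (4 * real_of_int p - 3)"
    using pos by simp
  also have "\<dots> \<longleftrightarrow> 4 * (real_of_int F - 1) * (real_of_int A)\<^sup>2 = 0"
    unfolding real_sqrt_eq_iff eq by auto
  also have "\<dots> \<longleftrightarrow> F = 1" using assms(1) by simp
  finally show "2 * real_of_int A - 1 = sqrt (4 * real_of_int p - 3) \<longleftrightarrow> F = 1" .
qed

theorem theorem4p4:
  fixes n p q r :: int
  assumes "K3N n p q r"
  shows "real_of_int (parC p q r) \<le>
           1/2 * (real_of_int p ^ 2 + 2 * real_of_int p + 1/2 * sqrt (4 * real_of_int p - 3) + 1/2)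
         \<and> (real_of_int (parC p q r) =
           1/2 * (real_of_int p ^ 2 + 2 * real_of_int p + 1/2 * sqrt (4 * real_of_int p - 3) + 1/2)
         \<longleftrightarrow> parE p q r = 2 \<and> parF p q r = 1 \<and> parG p q r = 1)"
proof -
  obtain A B C E F G H :: int where
    defs: "A = parA p q r" "B = parB p q r" "C = parC p q r" "E = parE p q r" "H = parH p q r"
    and FG: "parF p q r = F" "parG p q r = G"
    and pos: "0 < H" "0 < A" "0 < B" "0 < C" "2 \<le> E" "0 < F" "0 < G"
    and p: "p = H * A + 1" and C: "C * E = p * B + A" and G: "G * B = p + E"
    and F: "F * A = G + H"
    by (rule K3N_parameters[OF assms])
  let ?s = "sqrt (4 * real_of_int p - 3)"
  show ?thesis
  proof (cases "G = 1")
    case True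
    have "B = p + E" "F * A = 1 + H" using G F True by simp_all
    note b = two_C_le_if_G_eq_1[OF pos(2,5) C this(1)] A_le_if_G_eq_1[OF pos(2,6) p this(2)]
    have "real_of_int (2 * C) \<le> real_of_int (p\<^sup>2 + 2 * p + A)"
      using b(1) by (simp only: of_int_le_iff)
    then have le: "2 * real_of_int C \<le> (real_of_int p)\<^sup>2 + 2 * real_of_int p + real_of_int A"
      by simp
    have "real_of_int (2 * C) = real_of_int (p\<^sup>2 + 2 * p + A) \<longleftrightarrow> E = 2"
      using b(2) by (simp only: of_int_eq_iff)
    then have iff: "2 * real_of_int C = (real_of_int p)\<^sup>2 + 2 * real_of_int p + real_of_int A
        \<longleftrightarrow> E = 2"
      by simp
    \<comment> \<open>The bound is the sum of the inequalities for \<open>C\<close> and for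
      \<open>A\<close>, so it is attained iff both are equalities.\<close>
    have "real_of_int C = 1/2 * ((real_of_int p)\<^sup>2 + 2 * real_of_int p + 1/2 * ?s + 1/2)
        \<longleftrightarrow> 2 * real_of_int C = (real_of_int p)\<^sup>2 + 2 * real_of_int p + real_of_int A
          \<and> 2 * real_of_int A - 1 = ?s"
      using le b(3) by argo
    then show ?thesis
      unfolding FG defs(3,4)[symmetric] iff b(4) using le b(3) True by simp
  next
    case False
    have "1 * A \<le> H * A" using pos by (intro mult_right_mono) auto
    then have Ap: "A < p" using p by simp
    have "2 * C < p\<^sup>2 + 2 * p"
      using two_C_less_if_G_ge_2[OF pos(2) Ap pos(3-5) _ C G] pos(7) False by simp
    then have "real_of_int (2 * C) < real_of_int (p\<^sup>2 + 2 * p)"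
      by (simp only: of_int_less_iff)
    then have "2 * real_of_int C < (real_of_int p)\<^sup>2 + 2 * real_of_int p" by simp
    moreover have "0 \<le> ?s" using Ap pos(2) by simp
    \<comment> \<open>Strictness rules out equality, in accordance with \<open>G \<noteq> 1\<close>:
      both sides of the equivalence are false.\<close>
    ultimately have
      "real_of_int C < 1/2 * ((real_of_int p)\<^sup>2 + 2 * real_of_int p + 1/2 * ?s + 1/2)"
      by argo
    then show ?thesis unfolding FG defs(3)[symmetric] using False by simp
  qed
qed

end
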